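(* Let $\mathcal{J}(\mathcal{A},\mathcal{B}) = \bigcup_{s=1}^{n-2} \bigcup_{J_s = (j_1,\ldots,j_s) \preceq (1,\ldots,n)} \mathcal{E}^{\pm}(\mathcal{A}_{J_s},\mathcal{B}_{J_s})$. For all $c \in \mathbb{R}\setminus \mathcal{J}(\mathcal{A},\mathcal{B})$, $r^{\pm}_{\mathcal{A},\mathcal{B}}(c) < \infty$.
   Context: Let $\mathcal{A} = (A_1,\ldots, A_n)$ be a sequence of nonempty finite sets of positive real numbers, and let $\mathcal{B} = (B_1,\ldots, B_n)$ be a sequence of infinite discrete sets of positive real numbers (a set $B$ is discrete if $B\cap X$ is finite for every bounded set $X$). Let $\mathcal{E}^{\pm}(\mathcal{A},\mathcal{B}) = \{ \sum_{i=1}^n \varepsilon_i a_i/b_i : a_i \in A_i,\ b_i \in B_i,\ \varepsilon_i \in \{1,-1\} \}$ be the set of signed weighted real Egyptian numbers, and for $c \in \mathbb{R}$ let $r^{\pm}_{\mathcal{A},\mathcal{B}}(c)$ be the number of $3n$-tuples $(a_1,\ldots,a_n,b_1,\ldots,b_n,\varepsilon_1,\ldots,\varepsilon_n) \in A_1\times\cdots\times A_n\times B_1\times\cdots\times B_n\times\{1,-1\}^n$ with $\sum_{i=1}^n \varepsilon_i a_i/b_i = c$. For integers $j_1,\ldots,j_s$, write $(j_1,\ldots,j_s) \preceq (1,\ldots,n)$ if $1 \le j_1 < \cdots < j_s \le n$; for such $J$, $\mathcal{A}_J = (A_{j_1},\ldots,A_{j_s})$ and $\mathcal{B}_J = (B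_{j_1},\ldots,B_{j_s})$.
   Formalization: The case c = 0 with n ≥ 2 is excluded, because the claim can fail there: for n = 2, A_i = {1}, B_i the positive integers, the exceptional set is empty but 0 = 1/b − 1/b for every b. *)

theory Defs
  imports "HOL-Analysis.Analysis" "HOL-Library.Extended_Nat"
begin

(* Sequences of length n are functions on nat of which only the values at 1, ..., n matter. *)

(* Stronger than the library's topological notion "discrete": no accumulation
   point anywhere in the ambient space. *)
definition boundedly_finite :: "real set \<Rightarrow> bool" where
  "boundedly_finite B \<longleftrightarrow> (\<forall>X. bounded X \<longrightarrow> finite (B \<inter> X))"

definition signed_egyptian :: "nat \<Rightarrow> (nat \<Rightarrow> real set) \<Rightarrow> (nat \<Rightarrow> real set) \<Rightarrow> real set" where
  "signed_egyptian n A B =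
     {\<Sum>i=1..n. \<epsilon> i * a i / b i | \<epsilon> a b.
        \<forall>i\<in>{1..n}. a i \<in> A i \<and> b i \<in> B i \<and> \<epsilon> i \<in> {1, -1}}"

(* PiE fixes the values outside 1, ..., n, so that each tuple is counted exactly once. *)
definition signed_reps ::
  "nat \<Rightarrow> (nat \<Rightarrow> real set) \<Rightarrow> (nat \<Rightarrow> real set) \<Rightarrow> real
     \<Rightarrow> ((nat \<Rightarrow> real) \<times> (nat \<Rightarrow> real) \<times> (nat \<Rightarrow> real)) set" where
  "signed_reps n A B c =
     {(a, b, \<epsilon>). a \<in> PiE {1..n} A \<and> b \<in> PiE {1..n} B \<and> \<epsilon> \<in> PiE {1..n} (\<lambda>_. {1, -1}) \<and>
        (\<Sum>i=1..n. \<epsilon> i * a i / b i) = c}"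

definition rep_number ::
  "nat \<Rightarrow> (nat \<Rightarrow> real set) \<Rightarrow> (nat \<Rightarrow> real set) \<Rightarrow> real \<Rightarrow> enat" where
  "rep_number n A B c =
     (if finite (signed_reps n A B c) then enat (card (signed_reps n A B c)) else \<infinity>)"

definition index_subseq :: "nat \<Rightarrow> nat \<Rightarrow> (nat \<Rightarrow> nat) \<Rightarrow> bool" where
  "index_subseq s n j \<longleftrightarrow> strict_mono_on {1..s} j \<and> j ` {1..s} \<subseteq> {1..n}"

(* The truncated subtraction n - 2 is harmless: for n \<le> 2 the union over s is empty.
   The empty subsum 0 (s = 0) is not included, hence 0 can have infinitely many
   representations without being exceptional: with n = 2, A i = {1} and B i the positive
   integers, 0 = 1/b - 1/b for every b. For n = 1, 0 has no representation. *)
definition exceptional_set :: "nat \<Rightarrow> (nat \<Rightarrow> real set) \<Rightarrow> (nat \<Rightarrow> real set) \<Rightarrow> real set" where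
  "exceptional_set n A B =
     (\<Union>s\<in>{1..n - 2}. \<Union>j\<in>{j. index_subseq s n j}. signed_egyptian s (A \<circ> j) (B \<circ> j))"

end

theory Submission
  imports Defs
begin

text \<open>
  Given infinitely many representations of \<open>c\<close>, fix as many terms as possible so that infinitely
  many representations remain. By maximality every remaining term takes each of its values only
  finitely often, hence tends to 0, so \<open>c\<close> is already the sum of the fixed terms. At least two
  terms remain, for a single one would have to vanish; hence \<open>c\<close> is either 0 (no term fixed) or
  a sum of between 1 and \<open>n - 2\<close> terms.
\<close>

text \<open>Take \<open>J\<close> maximal under inclusion among the index sets on which some
  \<open>g\<close> can be prescribed with infinitely many members of \<open>F\<close> left;
  \<open>{}\<close> is one of them. A value occurring infinitely often at a free index would allow
  \<open>J\<close> to be enlarged.\<close>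

lemma infinite_fibre_maximal:
  fixes F :: "('i \<Rightarrow> 'x) set"
  assumes "finite I" "infinite F" "F \<subseteq> PiE I X"
  obtains J g where "J \<subset> I" "infinite {f \<in> F. \<forall>i\<in>J. f i = g i}"
    "\<forall>i\<in>I - J. \<forall>x. finite {f \<in> F. (\<forall>k\<in>J. f k = g k) \<and> f i = x}"
proof -
  define P where "P J \<longleftrightarrow> J \<subseteq> I \<and> (\<exists>g. infinite {f \<in> F. \<forall>i\<in>J. f i = g i})" for J
  have "P {}"
    using assms by (simp add: P_def)
  moreover have "finite {J. P J}"
    using assms(1) by (intro finite_subset[of "{J. P J}" "Pow I"]) (auto simp: P_def)
  ultimately obtain J where J: "P J" and maxJ: "\<And>K. P K \<Longrightarrow> J \<subseteq> K \<Longrightarrow> K = J"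
    using finite_has_maximal[of "{J. P J}"] by blast
  then obtain g where g: "infinite {f \<in> F. \<forall>i\<in>J. f i = g i}" and JI: "J \<subseteq> I"
    by (auto simp: P_def)
  have "J \<noteq> I"
  proof
    assume "J = I"
    \<comment> \<open>Members of \<open>PiE I X\<close> are \<open>undefined\<close> outside
      \<open>I\<close>, so prescribing all values on \<open>I\<close> leaves at most one
      function.\<close>
    then have "{f \<in> F. \<forall>i\<in>J. f i = g i} \<subseteq> {restrict g I}"
      using assms(3) by (force simp: PiE_iff extensional_def restrict_def fun_eq_iff)
    with g show False
      using finite_subset by blast
  qed
  moreover have "finite {f \<in> F. (\<forall>k\<in>J. f k = g k) \<and> f i = x}" if i: "i \<in> I - J" for i x
  proof (rule ccontr)
    assume inf: "infinite {f \<in> F. (\<forall>k\<in>J. f k = g k) \<and> f i = x}"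
    \<comment> \<open>Since \<open>i\<close> is not in \<open>J\<close>, updating \<open>g\<close>
      at \<open>i\<close> keeps the values prescribed on \<open>J\<close>.\<close>
    have "{f \<in> F. (\<forall>k\<in>J. f k = g k) \<and> f i = x} = {f \<in> F. \<forall>k\<in>insert i J. f k = (g(i := x)) k}"
      using i by auto
    then have "infinite {f \<in> F. \<forall>k\<in>insert i J. f k = (g(i := x)) k}"
      using inf by simp
    moreover have "insert i J \<subseteq> I"
      using i JI by blast
    ultimately have "P (insert i J)"
      unfolding P_def by blast
    with maxJ i show False
      by blast
  qed
  ultimately show thesis
    using that g JI by blast
qed

text \<open>Here \<open>fin\<close> says that the terms at each index tend to 0. Infinitely many
  solutions that agree on \<open>J\<close> thus contain some whose free terms are all as small as
  desired, which forces the fixed part to equal \<open>c\<close>.\<close>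

lemma infinite_sum_fibre_subsum:
  fixes v :: "'x \<Rightarrow> real"
  assumes I: "finite I"
    and inf: "infinite {f \<in> PiE I X. (\<Sum>i\<in>I. v (f i)) = c}"
    and fin: "\<And>i \<delta>. i \<in> I \<Longrightarrow> \<delta> > 0 \<Longrightarrow> finite {x \<in> X i. \<bar>v x\<bar> \<ge> \<delta>}"
    and nz: "\<And>i x. i \<in> I \<Longrightarrow> x \<in> X i \<Longrightarrow> v x \<noteq> 0"
  obtains J f where "J \<subseteq> I" "card (I - J) \<ge> 2" "f \<in> PiE I X" "(\<Sum>i\<in>J. v (f i)) = c"
proof -
  define F where "F = {f \<in> PiE I X. (\<Sum>i\<in>I. v (f i)) = c}"
  have FX: "F \<subseteq> PiE I X" and infF: "infinite F"
    using inf by (auto simp: F_def)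
  obtain J g where JI: "J \<subset> I" and G: "infinite {f \<in> F. \<forall>i\<in>J. f i = g i}"
    and fibre: "\<forall>i\<in>I - J. \<forall>x. finite {f \<in> F. (\<forall>k\<in>J. f k = g k) \<and> f i = x}"
    by (rule infinite_fibre_maximal[OF I infF FX])
  define G where "G = {f \<in> F. \<forall>i\<in>J. f i = g i}"
  define s where "s = (\<Sum>i\<in>J. v (g i))"
  have split: "c = (\<Sum>i\<in>J. v (f i)) + (\<Sum>i\<in>I - J. v (f i))" "(\<Sum>i\<in>J. v (f i)) = s"
    "f \<in> PiE I X" if "f \<in> G" for f
    using that I JI by (auto simp: G_def F_def s_def sum.subset_diff[of J I])
  have small: "\<bar>c - s\<bar> \<le> real (card (I - J)) * \<delta>" if "\<delta> > 0" for \<delta>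
  proof -
    \<comment> \<open>These are the members of \<open>G\<close> with some free term of size at least
      \<delta>: finitely many indices, finitely many large values at each by \<open>fin\<close>, and
      finitely many functions for each value by \<open>fibre\<close>. As \<open>G\<close> is
      infinite, one of its members avoids them.\<close>
    have "finite (\<Union>i\<in>I - J. \<Union>x\<in>{x \<in> X i. \<bar>v x\<bar> \<ge> \<delta>}. {f \<in> F. (\<forall>k\<in>J. f k = g k) \<and> f i = x})"
      using I fin fibre that by blast
    then have "\<not> G \<subseteq> (\<Union>i\<in>I - J. \<Union>x\<in>{x \<in> X i. \<bar>v x\<bar> \<ge> \<delta>}. {f \<in> F. (\<forall>k\<in>J. f k = g k) \<and> f i = x})"
      using G finite_subset unfolding G_def by blast
    then obtain f where f: "f \<in> G"
      and "f \<notin> (\<Union>i\<in>I - J. \<Union>x\<in>{x \<in> X i. \<bar>v x\<bar> \<ge> \<delta>}. {f \<in> F. (\<forall>k\<in>J. f k = g k) \<and> f i = x})"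
      by blast
    then have "\<bar>v (f i)\<bar> \<le> \<delta>" if "i \<in> I - J" for i
      using that FX by (force simp: G_def PiE_iff)
    then have "(\<Sum>i\<in>I - J. \<bar>v (f i)\<bar>) \<le> real (card (I - J)) * \<delta>"
      by (rule sum_bounded_above)
    moreover have "\<bar>\<Sum>i\<in>I - J. v (f i)\<bar> \<le> (\<Sum>i\<in>I - J. \<bar>v (f i)\<bar>)"
      by (rule sum_abs)
    ultimately show ?thesis
      using split[OF f] by linarith
  qed
  have card_pos: "card (I - J) > 0"
    using I JI by (auto simp: card_gt_0_iff)
  have "\<bar>c - s\<bar> \<le> 0 + e" if "e > 0" for e
    using small[of "e / real (card (I - J))"] card_pos that by simp
  then have cs: "c = s"
    using field_le_epsilon[of "\<bar>c - s\<bar>" 0] by simp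
  \<comment> \<open>\<open>g\<close> need not lie in \<open>PiE I X\<close>; a member of
    \<open>G\<close> does, and it has the same sum \<open>s\<close> over \<open>J\<close>.\<close>
  obtain f where f: "f \<in> G"
    using G by (auto simp: G_def dest: infinite_imp_nonempty)
  \<comment> \<open>A single free term would equal \<open>c - s = 0\<close>, against
    \<open>nz\<close>.\<close>
  have "card (I - J) \<noteq> 1"
  proof
    assume "card (I - J) = 1"
    then obtain i where i: "I - J = {i}"
      by (auto simp: card_1_singleton_iff)
    then have "v (f i) = 0"
      using split[OF f] cs by simp
    moreover have "i \<in> I" "f i \<in> X i"
      using i split(3)[OF f] by (auto simp: PiE_iff)
    ultimately show False
      using nz by blast
  qed
  then show thesis
    using that[of J f] JI card_pos split[OF f] cs by fastforce
qed

text \<open>For each of the finitely many \<open>a\<close>, a term of size at least \<delta> forces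
  \<open>b \<le> a / \<delta>\<close>, and only finitely many elements of \<open>B\<close> lie in
  that bounded range.\<close>

lemma finite_large_weighted_reciprocals:
  fixes A B :: "real set"
  assumes "finite A" "A \<subseteq> {0<..}" "boundedly_finite B" "B \<subseteq> {0<..}" "\<delta> > 0"
  shows "finite {x \<in> A \<times> B \<times> {1, -1}. \<bar>snd (snd x) * fst x / fst (snd x)\<bar> \<ge> \<delta>}"
proof (rule finite_subset)
  have "b \<le> a / \<delta>" if "a \<in> A" "b \<in> B" "\<delta> \<le> \<bar>a\<bar> / \<bar>b\<bar>" for a b
  proof -
    have "a > 0" "b > 0"
      using assms that by auto
    with that(3) assms(5) show ?thesis
      by (simp add: field_simps)
  qed
  then show "{x \<in> A \<times> B \<times> {1, -1}. \<bar>snd (snd x) * fst x / fst (snd x)\<bar> \<ge> \<delta>}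
      \<subseteq> (\<Union>a\<in>A. {a} \<times> (B \<inter> {0..a / \<delta>}) \<times> {1, -1})"
    using assms(4) by (auto simp: abs_mult intro: less_imp_le)
  show "finite (\<Union>a\<in>A. {a} \<times> (B \<inter> {0..a / \<delta>}) \<times> {1, -1 :: real})"
    using assms by (auto simp: boundedly_finite_def)
qed

text \<open>The increasing enumeration of \<open>J\<close> is the index subsequence required by
  \<open>exceptional_set\<close>.\<close>

lemma subsum_in_exceptional_set:
  assumes "J \<subseteq> {1..n}" "J \<noteq> {}" "card J \<le> n - 2"
    and abe: "\<And>i. i \<in> J \<Longrightarrow> a i \<in> A i \<and> b i \<in> B i \<and> \<epsilon> i \<in> {1, -1}"
  shows "(\<Sum>i\<in>J. \<epsilon> i * a i / b i) \<in> exceptional_set n A B"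
proof -
  have finJ: "finite J"
    using assms(1) finite_subset by blast
  obtain h where h: "bij_betw h {..<card J} J" "strict_mono_on {..<card J} h"
    using ex_bij_betw_strict_mono_card[OF finJ] by metis
  \<comment> \<open>\<open>h\<close> enumerates from 0, whereas \<open>index_subseq\<close> counts
    from 1.\<close>
  define j where "j = (\<lambda>k. h (k - 1))"
  have pred: "bij_betw (\<lambda>k. k - 1) {1..card J} {..<card J}"
    by (rule bij_betw_byWitness[where f' = Suc]) auto
  have j: "bij_betw j {1..card J} J"
    using bij_betw_trans[OF pred h(1)] by (simp add: j_def comp_def)
  have "strict_mono_on {1..card J} j"
    using h(2) by (intro strict_mono_onI) (auto simp: j_def elim!: strict_mono_onD)
  then have idx: "index_subseq (card J) n j"
    using j assms(1) by (simp add: index_subseq_def bij_betw_def)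
  have "(\<Sum>i\<in>J. \<epsilon> i * a i / b i) = (\<Sum>k=1..card J. (\<epsilon> \<circ> j) k * (a \<circ> j) k / (b \<circ> j) k)"
    using sum.reindex_bij_betw[OF j, of "\<lambda>i. \<epsilon> i * a i / b i"] by simp
  moreover have "\<forall>k\<in>{1..card J}. (a \<circ> j) k \<in> (A \<circ> j) k \<and> (b \<circ> j) k \<in> (B \<circ> j) k \<and> (\<epsilon> \<circ> j) k \<in> {1, -1}"
    using abe bij_betwE[OF j] by simp
  ultimately have "(\<Sum>i\<in>J. \<epsilon> i * a i / b i) \<in> signed_egyptian (card J) (A \<circ> j) (B \<circ> j)"
    unfolding signed_egyptian_def by blast
  moreover have "card J \<in> {1..n - 2}"
    using assms finJ by (simp add: Suc_le_eq card_gt_0_iff)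
  ultimately show ?thesis
    using idx by (auto simp: exceptional_set_def)
qed

theorem theorem3:
  fixes n :: nat and A B :: "nat \<Rightarrow> real set" and c :: real
  assumes "n \<ge> 1"
    and "\<And>i. i \<in> {1..n} \<Longrightarrow> A i \<noteq> {} \<and> finite (A i) \<and> A i \<subseteq> {0<..}"
    and "\<And>i. i \<in> {1..n} \<Longrightarrow> infinite (B i) \<and> boundedly_finite (B i) \<and> B i \<subseteq> {0<..}"
    and "c \<in> UNIV - exceptional_set n A B"
    and zero_excluded: "c \<noteq> 0 \<or> n = 1"
  shows "rep_number n A B c < \<infinity>"
proof -
  define X where "X = (\<lambda>i. A i \<times> B i \<times> {1, -1 :: real})"
  define v where "v = (\<lambda>x :: real \<times> real \<times> real. snd (snd x) * fst x / fst (snd x))"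
  \<comment> \<open>A triple of functions becomes one function into triples, so that fixing a
    coordinate fixes the whole term. Restricting to \<open>{1..n}\<close> puts the result into
    \<open>PiE {1..n} X\<close>.\<close>
  define merge where "merge = (\<lambda>(a, b, \<epsilon>). restrict (\<lambda>i :: nat. (a i, b i, \<epsilon> i) :: real \<times> real \<times> real) {1..n})"
  have "finite (signed_reps n A B c)"
  proof (rule ccontr)
    assume inf: "infinite (signed_reps n A B c)"
    \<comment> \<open>\<open>merge\<close> forgets values outside \<open>{1..n}\<close>, but there
      all three components are \<open>undefined\<close> by \<open>PiE\<close>.\<close>
    have "inj_on merge (signed_reps n A B c)"
    proof (rule inj_onI)
      fix p q
      assume pq: "p \<in> signed_reps n A B c" "q \<in> signed_reps n A B c" "merge p = merge q"
      obtain a b \<epsilon> a' b' \<epsilon>' where eqs: "p = (a, b, \<epsilon>)" "q = (a', b', \<epsilon>')"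
        by (metis prod_cases3)
      with pq have reps: "(a, b, \<epsilon>) \<in> signed_reps n A B c" "(a', b', \<epsilon>') \<in> signed_reps n A B c"
        and "merge (a, b, \<epsilon>) = merge (a', b', \<epsilon>')"
        by auto
      then have "a i = a' i \<and> b i = b' i \<and> \<epsilon> i = \<epsilon>' i" if "i \<in> {1..n}" for i
        using that by (auto simp: merge_def dest!: fun_cong[of _ _ i])
      with reps have "a = a' \<and> b = b' \<and> \<epsilon> = \<epsilon>'"
        unfolding signed_reps_def by (blast intro: PiE_ext)
      with eqs show "p = q"
        by simp
    qed
    moreover have "merge ` signed_reps n A B c \<subseteq> {f \<in> PiE {1..n} X. (\<Sum>i=1..n. v (f i)) = c}"
      by (auto simp: merge_def signed_reps_def X_def v_def PiE_iff)
    ultimately have inf': "infinite {f \<in> PiE {1..n} X. (\<Sum>i=1..n. v (f i)) = c}"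
      using inf finite_imageD finite_subset by blast
    have fin: "finite {x \<in> X i. \<bar>v x\<bar> \<ge> \<delta>}" if "i \<in> {1..n}" "\<delta> > 0" for i \<delta>
      unfolding X_def v_def using assms(2,3)[OF that(1)] that(2)
      by (intro finite_large_weighted_reciprocals) auto
    have nz: "v x \<noteq> 0" if "i \<in> {1..n}" "x \<in> X i" for i x
      using assms(2,3)[OF that(1)] that(2) by (auto simp: X_def v_def)
    obtain J f where J: "J \<subseteq> {1..n}" "card ({1..n} - J) \<ge> 2"
      and f: "f \<in> PiE {1..n} X" and sum: "(\<Sum>i\<in>J. v (f i)) = c"
      by (rule infinite_sum_fibre_subsum[OF finite_atLeastAtMost inf' fin nz])
    have card: "n - card J \<ge> 2"
      using J card_Diff_subset[of J "{1..n}"] finite_subset[OF J(1)] by simp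
    show False
    proof (cases "J = {}")
      \<comment> \<open>The empty sum gives \<open>c = 0\<close>, while \<open>card\<close> gives
        \<open>n \<ge> 2\<close>; exactly this combination is ruled out by
        \<open>zero_excluded\<close>.\<close>
      case True
      with sum card zero_excluded show False
        by auto
    next
      case False
      have "f i \<in> X i" if "i \<in> J" for i
        using f J(1) that by (auto simp: PiE_iff)
      then have "(\<Sum>i\<in>J. snd (snd (f i)) * fst (f i) / fst (snd (f i))) \<in> exceptional_set n A B"
        using J(1) False card by (intro subsum_in_exceptional_set) (auto simp: X_def mem_Times_iff)
      with sum assms(4) show False
        by (simp add: v_def)
    qed
  qed
  then show ?thesis
    by (simp add: rep_number_def)
qed

end
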